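(* For every FO learning framework $\mathfrak F$, its possibilistic extension $\mathfrak F_\pi$ is learnable with only equivalence queries.
   Context: $L$ is a propositional or first-order (FO) language with classical semantics; an FO KB is a finite set of FO formulas. A possibilistic formula is $(\varphi,\alpha)$ with $\varphi\in L$ and $\alpha\in(0,1]$ a real with finitely many decimal digits; a possibilistic KB is a finite set of them. For interpretations $\Omega$, a possibility distribution $\pi:\Omega\to[0,1]$ has necessity $N(\varphi)=\inf\{1-\pi(\mathcal I)\mid\mathcal I\models\neg\varphi\}$ ($\inf\emptyset=1$); $\pi$ satisfies $(\varphi,\alpha)$ iff $N(\varphi)\ge\alpha$; a KB $K$ entails $(\varphi,\alpha)$ iff every distribution satisfying all elements of $K$ satisfies $(\varphi,\alpha)$; KBs are equivalent ($\equiv$) iff they entail the same formulas. A learning framework is a pair $(E,H)$ of non-empty countable sets (examples, hypotheses), each $l\in H$ with finite signature $\Sigma_l$; it is FO if $E$ consists of FO formulas and $H$ of FO KBs. For target $t\in H$, the equivalence oracle, on input $h\in H$, answers "yes" if $h\equiv t$ and otherwise returns an arbitrary counterexample $e\in E$ with ($t\models e$ and $h\not\models e$) or ($h\models e$ and $t\not\models e$). A learner with only equivalence queries is a deterministic algorithm which, for every $t\in H$, given $\Sigma_t$ and access to the equivalence oracle for $t$, eventually halts with some $h\in H$, $h\equiv t$; the framework is learnable with only equivalence queries if such a learner exists. A possibilistic extension of an FO KB $l$ is obtained by attaching a valuation to each formula of $l$. $\mathfrak F_\pi=(E_\pi,H_\pi)$ has $H_\pi$ the set of all possibilistic extensions of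 elements of $H$ and $E_\pi$ the set of possibilistic formulas entailed by some element of $H_\pi$.
   Formalization: The learner is also given access to an arbitrary enumeration of (codes of) the hypotheses in H; without it the claim fails, e.g. for H = {{"exactly n elements"} : n in A} with A not recursively enumerable. *)

theory Defs
  imports Complex_Main "HOL-Library.Nat_Bijection" "HOL-Library.Countable_Set"
begin

section \<open>First-order logic\<close>

text \<open>
  A function or predicate symbol is a name together with an arity, the arity being the length of
  the argument list: a name used with two different arities stands for two different symbols.
  Constants and propositional variables are the symbols of arity 0.
\<close>

datatype tm = Var nat | Fun nat "tm list"

datatype fm =
    Rel nat "tm list"
  | Eq tm tm
  | Neg fm
  | Conj fm fm
  | Disj fm fm
  | Imp fm fm
  | All nat fm
  | Ex nat fm

datatype sym = FunSym nat nat | RelSym nat nat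

primrec tm_syms :: "tm \<Rightarrow> sym set" where
  "tm_syms (Var x) = {}"
| "tm_syms (Fun f ts) = insert (FunSym f (length ts)) (\<Union> (set (map tm_syms ts)))"

primrec fm_syms :: "fm \<Rightarrow> sym set" where
  "fm_syms (Rel r ts) = insert (RelSym r (length ts)) (\<Union> (set (map tm_syms ts)))"
| "fm_syms (Eq s t) = tm_syms s \<union> tm_syms t"
| "fm_syms (Neg \<phi>) = fm_syms \<phi>"
| "fm_syms (Conj \<phi> \<psi>) = fm_syms \<phi> \<union> fm_syms \<psi>"
| "fm_syms (Disj \<phi> \<psi>) = fm_syms \<phi> \<union> fm_syms \<psi>"
| "fm_syms (Imp \<phi> \<psi>) = fm_syms \<phi> \<union> fm_syms \<psi>"
| "fm_syms (All x \<phi>) = fm_syms \<phi>"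
| "fm_syms (Ex x \<phi>) = fm_syms \<phi>"

text \<open>
  An interpretation consists of a structure, whose domain is an arbitrary non-empty subset of the
  type \<open>'u\<close>, and an assignment to the variables, so that open formulas have a truth value as well.
  By the downward Loewenheim-Skolem theorem every infinite \<open>'u\<close> yields the classical consequence
  relation (all formulas here are over the countably many symbols above).
\<close>

record 'u interp =
  dom :: "'u set"
  fn :: "nat \<Rightarrow> 'u list \<Rightarrow> 'u"
  rl :: "nat \<Rightarrow> 'u list \<Rightarrow> bool"
  asg :: "nat \<Rightarrow> 'u"

definition interps :: "'u interp set" where
  "interps = {I. dom I \<noteq> {} \<and> (\<forall>f xs. set xs \<subseteq> dom I \<longrightarrow> fn I f xs \<in> dom I) \<and>
                 range (asg I) \<subseteq> dom I}"

primrec tm_val :: "'u interp \<Rightarrow> (nat \<Rightarrow> 'u) \<Rightarrow> tm \<Rightarrow> 'u" where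
  "tm_val I s (Var x) = s x"
| "tm_val I s (Fun f ts) = fn I f (map (tm_val I s) ts)"

primrec sat :: "'u interp \<Rightarrow> (nat \<Rightarrow> 'u) \<Rightarrow> fm \<Rightarrow> bool" where
  "sat I s (Rel r ts) \<longleftrightarrow> rl I r (map (tm_val I s) ts)"
| "sat I s (Eq t u) \<longleftrightarrow> tm_val I s t = tm_val I s u"
| "sat I s (Neg \<phi>) \<longleftrightarrow> \<not> sat I s \<phi>"
| "sat I s (Conj \<phi> \<psi>) \<longleftrightarrow> sat I s \<phi> \<and> sat I s \<psi>"
| "sat I s (Disj \<phi> \<psi>) \<longleftrightarrow> sat I s \<phi> \<or> sat I s \<psi>"
| "sat I s (Imp \<phi> \<psi>) \<longleftrightarrow> (sat I s \<phi> \<longrightarrow> sat I s \<psi>)"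
| "sat I s (All x \<phi>) \<longleftrightarrow> (\<forall>a \<in> dom I. sat I (s(x := a)) \<phi>)"
| "sat I s (Ex x \<phi>) \<longleftrightarrow> (\<exists>a \<in> dom I. sat I (s(x := a)) \<phi>)"

definition models :: "'u interp \<Rightarrow> fm \<Rightarrow> bool" where
  "models I \<phi> \<longleftrightarrow> sat I (asg I) \<phi>"

section \<open>Possibilistic logic\<close>

definition valuations :: "real set" where
  "valuations = {\<alpha>. 0 < \<alpha> \<and> \<alpha> \<le> 1 \<and> (\<exists>m k :: nat. \<alpha> = real m / 10 ^ k)}"

type_synonym pfm = "fm \<times> real"

definition pfms :: "pfm set" where
  "pfms = UNIV \<times> valuations"

definition distributions :: "('u interp \<Rightarrow> real) set" where
  "distributions = {\<pi>. \<forall>I \<in> interps. 0 \<le> \<pi> I \<and> \<pi> I \<le> 1}"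

definition necessity :: "('u interp \<Rightarrow> real) \<Rightarrow> fm \<Rightarrow> real" where
  "necessity \<pi> \<phi> =
     (let X = {1 - \<pi> I |I. I \<in> interps \<and> models I (Neg \<phi>)} in if X = {} then 1 else Inf X)"

definition psatisfies :: "('u interp \<Rightarrow> real) \<Rightarrow> pfm \<Rightarrow> bool" where
  "psatisfies \<pi> e \<longleftrightarrow> necessity \<pi> (fst e) \<ge> snd e"

definition pentails :: "'u itself \<Rightarrow> pfm set \<Rightarrow> pfm \<Rightarrow> bool" where
  "pentails U K e \<longleftrightarrow>
     (\<forall>\<pi> \<in> (distributions :: ('u interp \<Rightarrow> real) set).
        (\<forall>d \<in> K. psatisfies \<pi> d) \<longrightarrow> psatisfies \<pi> e)"

definition pequiv :: "'u itself \<Rightarrow> pfm set \<Rightarrow> pfm set \<Rightarrow> bool" where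
  "pequiv U K K' \<longleftrightarrow> (\<forall>e \<in> pfms. pentails U K e \<longleftrightarrow> pentails U K' e)"

definition pkb_syms :: "pfm set \<Rightarrow> sym set" where
  "pkb_syms K = (\<Union>e \<in> K. fm_syms (fst e))"

section \<open>Oracle computations\<close>

text \<open>Programs for the partial functions on \<open>nat\<close> that are recursive in an oracle \<open>\<gamma>\<close>.\<close>

datatype prog =
    Zero
  | Succ
  | Proj nat
  | Oracle
  | Comp prog "prog list"
  | PrimRec prog prog
  | Mu prog

inductive computes :: "(nat \<Rightarrow> nat) \<Rightarrow> prog \<Rightarrow> nat list \<Rightarrow> nat \<Rightarrow> bool" for \<gamma> where
  zero: "computes \<gamma> Zero xs 0"
| succ: "computes \<gamma> Succ [x] (Suc x)"
| proj: "i < length xs \<Longrightarrow> computes \<gamma> (Proj i) xs (xs ! i)"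
| oracle_call: "computes \<gamma> Oracle [x] (\<gamma> x)"
| comp: "\<lbrakk>length ys = length ps; \<forall>i < length ps. computes \<gamma> (ps ! i) xs (ys ! i);
          computes \<gamma> p ys z\<rbrakk> \<Longrightarrow> computes \<gamma> (Comp p ps) xs z"
| primrec_0: "computes \<gamma> p xs z \<Longrightarrow> computes \<gamma> (PrimRec p q) (0 # xs) z"
| primrec_Suc: "\<lbrakk>computes \<gamma> (PrimRec p q) (n # xs) r; computes \<gamma> q (r # n # xs) z\<rbrakk> \<Longrightarrow>
                computes \<gamma> (PrimRec p q) (Suc n # xs) z"
| mu: "\<lbrakk>computes \<gamma> p (n # xs) 0; \<forall>m < n. \<exists>y. computes \<gamma> p (m # xs) (Suc y)\<rbrakk> \<Longrightarrow>
       computes \<gamma> (Mu p) xs n"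

lemma computes_deterministic:
  "computes \<gamma> p xs y \<Longrightarrow> computes \<gamma> p xs z \<Longrightarrow> y = z"
proof (induction arbitrary: z rule: computes.induct)
  case (comp ys ps xs p y)
  note len = comp.hyps(1) and IH = comp.IH
  from comp.prems show ?case
  proof cases
    case (comp ys')
    have "ys = ys'"
    proof (rule nth_equalityI)
      show "length ys = length ys'" using comp len by simp
      show "ys ! i = ys' ! i" if "i < length ys" for i
        using that comp IH(1) len by simp
    qed
    then show ?thesis using comp IH(2) by simp
  qed
next
  case (primrec_Suc p q n xs r y)
  note IH = primrec_Suc.IH
  from primrec_Suc.prems show ?case
    by cases (use IH in blast)
next
  case (mu p n xs)
  note IH = mu.IH
  from mu.prems show ?case
  proof cases
    case mu
    show ?thesis
    proof (rule ccontr)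
      assume "n \<noteq> z"
      then consider "n < z" | "z < n" by linarith
      then show False
      proof cases
        case 1
        then obtain y where "computes \<gamma> p (n # xs) (Suc y)" using mu by blast
        then show False using IH(1) by blast
      next
        case 2
        then show False using IH(2) mu by blast
      qed
    qed
  qed
qed (erule computes.cases; simp)+

section \<open>Codes\<close>

primrec tm_encode :: "tm \<Rightarrow> nat" where
  "tm_encode (Var x) = sum_encode (Inl x)"
| "tm_encode (Fun f ts) = sum_encode (Inr (prod_encode (f, list_encode (map tm_encode ts))))"

primrec fm_encode :: "fm \<Rightarrow> nat" where
  "fm_encode (Rel r ts) =
     prod_encode (0, prod_encode (r, list_encode (map tm_encode ts)))"
| "fm_encode (Eq s t) = prod_encode (1, prod_encode (tm_encode s, tm_encode t))"
| "fm_encode (Neg \<phi>) = prod_encode (2, fm_encode \<phi>)"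
| "fm_encode (Conj \<phi> \<psi>) = prod_encode (3, prod_encode (fm_encode \<phi>, fm_encode \<psi>))"
| "fm_encode (Disj \<phi> \<psi>) = prod_encode (4, prod_encode (fm_encode \<phi>, fm_encode \<psi>))"
| "fm_encode (Imp \<phi> \<psi>) = prod_encode (5, prod_encode (fm_encode \<phi>, fm_encode \<psi>))"
| "fm_encode (All x \<phi>) = prod_encode (6, prod_encode (x, fm_encode \<phi>))"
| "fm_encode (Ex x \<phi>) = prod_encode (7, prod_encode (x, fm_encode \<phi>))"

primrec sym_encode :: "sym \<Rightarrow> nat" where
  "sym_encode (FunSym f n) = sum_encode (Inl (prod_encode (f, n)))"
| "sym_encode (RelSym r n) = sum_encode (Inr (prod_encode (r, n)))"

text \<open>
  Codes in the form of a relation between numbers and the objects they denote. Each number denotes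
  at most one object, but an object may have several codes: a finite set is given by any list of
  its elements, and the pair \<open>(m, k)\<close> denotes the decimal \<open>m / 10 ^ k\<close>.
\<close>

definition fm_code :: "nat \<Rightarrow> fm \<Rightarrow> bool" where
  "fm_code c \<phi> \<longleftrightarrow> c = fm_encode \<phi>"

definition sym_code :: "nat \<Rightarrow> sym \<Rightarrow> bool" where
  "sym_code c s \<longleftrightarrow> c = sym_encode s"

definition decimal_code :: "nat \<Rightarrow> real \<Rightarrow> bool" where
  "decimal_code c \<alpha> \<longleftrightarrow> (case prod_decode c of (m, k) \<Rightarrow> \<alpha> = real m / 10 ^ k)"

definition pfm_code :: "nat \<Rightarrow> pfm \<Rightarrow> bool" where
  "pfm_code c e \<longleftrightarrow> (case prod_decode c of (a, b) \<Rightarrow> fm_code a (fst e) \<and> decimal_code b (snd e))"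

definition set_code :: "(nat \<Rightarrow> 'a \<Rightarrow> bool) \<Rightarrow> nat \<Rightarrow> 'a set \<Rightarrow> bool" where
  "set_code C c A \<longleftrightarrow> rel_set C (set (list_decode c)) A"

lemma tm_encode_inject: "tm_encode s = tm_encode t \<Longrightarrow> s = t"
proof (induction s arbitrary: t)
  case (Var x)
  from Var.prems show ?case by (cases t) (simp_all add: inj_eq[OF inj_sum_encode])
next
  case (Fun f ts)
  from Fun.prems obtain us where t: "t = Fun f us" and us: "map tm_encode ts = map tm_encode us"
    by (cases t) (simp_all add: inj_eq[OF inj_sum_encode] inj_eq[OF inj_list_encode])
  from us have "ts = us"
    by (rule list.inj_map_strong[rotated]) (rule Fun.IH)
  with t show ?case by simp
qed

lemma fm_encode_inject: "fm_encode \<phi> = fm_encode \<psi> \<Longrightarrow> \<phi> = \<psi>"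
proof (induction \<phi> arbitrary: \<psi>)
  case (Rel r ts)
  from Rel.prems show ?case
    by (cases \<psi>)
      (simp_all add: inj_eq[OF inj_list_encode] inj_map_eq_map[OF injI[OF tm_encode_inject]])
next
  case (Eq s t)
  from Eq.prems show ?case by (cases \<psi>) (auto dest: tm_encode_inject)
next
  case (Neg \<phi>)
  from Neg.prems show ?case by (cases \<psi>) (auto dest: Neg.IH)
next
  case (Conj \<phi>1 \<phi>2)
  from Conj.prems show ?case by (cases \<psi>) (auto dest: Conj.IH)
next
  case (Disj \<phi>1 \<phi>2)
  from Disj.prems show ?case by (cases \<psi>) (auto dest: Disj.IH)
next
  case (Imp \<phi>1 \<phi>2)
  from Imp.prems show ?case by (cases \<psi>) (auto dest: Imp.IH)
next
  case (All x \<phi>)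
  from All.prems show ?case by (cases \<psi>) (auto dest: All.IH)
next
  case (Ex x \<phi>)
  from Ex.prems show ?case by (cases \<psi>) (auto dest: Ex.IH)
qed

section \<open>Exact learning with equivalence queries\<close>

text \<open>
  A framework consists of its examples and its hypotheses. The entailment, the equivalence, the
  signatures and the codes that go with it are collected in a record.
\<close>

type_synonym ('e, 'h) framework = "'e set \<times> 'h set"

record ('e, 'h) logic =
  entails :: "'h \<Rightarrow> 'e \<Rightarrow> bool"
  equivalent :: "'h \<Rightarrow> 'h \<Rightarrow> bool"
  signature :: "'h \<Rightarrow> sym set"
  ex_code :: "nat \<Rightarrow> 'e \<Rightarrow> bool"
  hyp_code :: "nat \<Rightarrow> 'h \<Rightarrow> bool"

text \<open>
  The possible answers of the equivalence oracle for \<open>t\<close> to the query \<open>h\<close>: 0 is ``yes'' and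
  \<open>Suc c\<close> is the counterexample with code \<open>c\<close>.
\<close>

definition eq_answer ::
  "('e, 'h) logic \<Rightarrow> ('e, 'h) framework \<Rightarrow> 'h \<Rightarrow> 'h \<Rightarrow> nat \<Rightarrow> bool" where
  "eq_answer L F t h a \<longleftrightarrow>
     (if equivalent L h t then a = 0
      else \<exists>c e. a = Suc c \<and> ex_code L c e \<and> e \<in> fst F \<and>
             (entails L t e \<and> \<not> entails L h e \<or> entails L h e \<and> \<not> entails L t e))"

text \<open>
  A deterministic algorithm that interacts with the equivalence oracle is given by the computable
  function that maps its input (a code \<open>\<sigma>\<close> of the signature of the target) and the answers received
  so far (most recent first) to its next action: querying a hypothesis (\<open>Inl\<close>) or halting with a
  hypothesis (\<open>Inr\<close>). Its earlier queries are not listed since it can recompute them.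

  \<open>succeeds \<dots> as\<close>: after the answers \<open>as\<close>, whatever further answers the oracle gives, the algorithm
  only queries hypotheses of the framework and eventually halts with one that is equivalent to \<open>t\<close>.
\<close>

inductive succeeds ::
  "(nat \<Rightarrow> nat) \<Rightarrow> ('e, 'h) logic \<Rightarrow> ('e, 'h) framework \<Rightarrow> prog \<Rightarrow> 'h \<Rightarrow> nat \<Rightarrow> nat list \<Rightarrow> bool"
  for \<gamma> L F p t \<sigma> where
  halt: "\<lbrakk>computes \<gamma> p [\<sigma>, list_encode as] (sum_encode (Inr c)); hyp_code L c h; h \<in> snd F;
          equivalent L h t\<rbrakk> \<Longrightarrow> succeeds \<gamma> L F p t \<sigma> as"
| query: "\<lbrakk>computes \<gamma> p [\<sigma>, list_encode as] (sum_encode (Inl c)); hyp_code L c h; h \<in> snd F;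
           \<forall>a. eq_answer L F t h a \<longrightarrow> succeeds \<gamma> L F p t \<sigma> (a # as)\<rbrakk> \<Longrightarrow>
          succeeds \<gamma> L F p t \<sigma> as"

text \<open>Learnability by an algorithm with access to \<open>\<gamma>\<close>.\<close>

definition learnable_eq :: "(nat \<Rightarrow> nat) \<Rightarrow> ('e, 'h) logic \<Rightarrow> ('e, 'h) framework \<Rightarrow> bool" where
  "learnable_eq \<gamma> L F \<longleftrightarrow>
     (\<exists>p. \<forall>t \<in> snd F. \<forall>\<sigma>. set_code sym_code \<sigma> (signature L t) \<longrightarrow> succeeds \<gamma> L F p t \<sigma> [])"

section \<open>First-order frameworks and their possibilistic extensions\<close>

definition FO_framework :: "(fm, fm set) framework \<Rightarrow> bool" where
  "FO_framework F \<longleftrightarrow> fst F \<noteq> {} \<and> countable (fst F) \<and> snd F \<noteq> {} \<and> countable (snd F) \<and>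
     (\<forall>l \<in> snd F. finite l)"

text \<open>
  An algorithm can only be designed for a framework whose hypotheses are accessible to it. The
  hypotheses are therefore presented by an arbitrary enumeration \<open>\<gamma>\<close> of codes for them; nothing is
  assumed about its computability.
\<close>

definition enumerates_hyps :: "(nat \<Rightarrow> nat) \<Rightarrow> (fm, fm set) framework \<Rightarrow> bool" where
  "enumerates_hyps \<gamma> F \<longleftrightarrow>
     (\<forall>i. \<exists>l \<in> snd F. set_code fm_code (\<gamma> i) l) \<and> (\<forall>l \<in> snd F. \<exists>i. set_code fm_code (\<gamma> i) l)"

lemma set_code_exists:
  assumes "finite A" and "\<And>x. x \<in> A \<Longrightarrow> \<exists>c. C c x"
  shows "\<exists>c. set_code C c A"
proof -
  obtain f where f: "\<And>x. x \<in> A \<Longrightarrow> C (f x) x" using assms(2) by metis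
  obtain xs where "set xs = A" using assms(1) finite_list by blast
  then have "set_code C (list_encode (map f xs)) A"
    using f by (auto simp: set_code_def rel_set_def)
  then show ?thesis by blast
qed

lemma enumeration_exists:
  assumes "FO_framework F"
  shows "\<exists>\<gamma>. enumerates_hyps \<gamma> F"
proof -
  have "\<exists>c. set_code fm_code c l" if "l \<in> snd F" for l
    using assms that by (intro set_code_exists) (auto simp: FO_framework_def fm_code_def)
  then obtain f where f: "\<And>l. l \<in> snd F \<Longrightarrow> set_code fm_code (f l) l" by metis
  define enum where "enum = from_nat_into (snd F)"
  have r: "range enum = snd F"
    using assms by (simp add: FO_framework_def enum_def)
  have "enumerates_hyps (\<lambda>i. f (enum i)) F"
    unfolding enumerates_hyps_def
  proof (intro conjI allI ballI)
    fix i
    have "enum i \<in> snd F" using r by blast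
    then show "\<exists>l \<in> snd F. set_code fm_code (f (enum i)) l" using f by blast
  next
    fix l assume l: "l \<in> snd F"
    then obtain i where "l = enum i" using r by blast
    then show "\<exists>i. set_code fm_code (f (enum i)) l" using f[OF l] by blast
  qed
  then show ?thesis by blast
qed

definition pextensions :: "fm set \<Rightarrow> pfm set set" where
  "pextensions l = {(\<lambda>\<phi>. (\<phi>, v \<phi>)) ` l |v. \<forall>\<phi> \<in> l. v \<phi> \<in> valuations}"

definition poss_framework ::
  "'u itself \<Rightarrow> (fm, fm set) framework \<Rightarrow> (pfm, pfm set) framework" where
  "poss_framework U F =
     (let H = (\<Union>l \<in> snd F. pextensions l) in ({e \<in> pfms. \<exists>h \<in> H. pentails U h e}, H))"

definition poss_logic :: "'u itself \<Rightarrow> (pfm, pfm set) logic" where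
  "poss_logic U =
     \<lparr>entails = pentails U, equivalent = pequiv U, signature = pkb_syms,
      ex_code = pfm_code, hyp_code = set_code pfm_code\<rparr>"

text \<open>The equivalence oracle always has an answer, and the signature of a target has a code.\<close>

lemma eq_answer_exists:
  assumes "t \<in> snd (poss_framework U F)" and "h \<in> snd (poss_framework U F)"
  shows "\<exists>a. eq_answer (poss_logic U) (poss_framework U F) t h a"
proof (cases "pequiv U h t")
  case True
  then show ?thesis by (simp add: eq_answer_def poss_logic_def)
next
  case False
  then obtain e where e: "e \<in> pfms" "pentails U h e \<noteq> pentails U t e"
    by (auto simp: pequiv_def)
  then have "snd e \<in> valuations" by (auto simp: pfms_def)
  then obtain m k where mk: "snd e = real m / 10 ^ k" unfolding valuations_def by blast
  have "pfm_code (prod_encode (fm_encode (fst e), prod_encode (m, k))) e"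
    using mk by (simp add: pfm_code_def fm_code_def decimal_code_def)
  moreover have "e \<in> fst (poss_framework U F)"
    using e assms by (auto simp: poss_framework_def Let_def)
  ultimately show ?thesis
    using False e(2) unfolding eq_answer_def poss_logic_def
    by (cases e) (simp, blast)
qed

lemma signature_code_exists:
  assumes "FO_framework F" and "t \<in> snd (poss_framework U F)"
  shows "\<exists>\<sigma>. set_code sym_code \<sigma> (signature (poss_logic U) t)"
proof (rule set_code_exists)
  have tm: "finite (tm_syms s)" for s by (induction s) auto
  have fm: "finite (fm_syms \<phi>)" for \<phi> by (induction \<phi>) (auto simp: tm)
  have "finite t"
    using assms by (auto simp: poss_framework_def Let_def pextensions_def FO_framework_def)
  then show "finite (signature (poss_logic U) t)" by (simp add: poss_logic_def pkb_syms_def fm)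
qed (simp add: sym_code_def)

end

theory Submission
  imports Defs
begin

text \<open>
  The possibilistic extensions of the hypotheses can be enumerated effectively from \<open>\<gamma>\<close>, since
  every formula admits only countably many valuations. The learner queries them one after the other
  and halts at the first answer ``yes''; the counterexamples are ignored. The answer must be ``yes''
  at the latest when the target itself is queried.
\<close>

section \<open>Total functions recursive in an oracle\<close>

definition computable :: "(nat \<Rightarrow> nat) \<Rightarrow> nat \<Rightarrow> (nat list \<Rightarrow> nat) \<Rightarrow> bool" where
  "computable \<gamma> n f \<longleftrightarrow> (\<exists>p. \<forall>xs. length xs = n \<longrightarrow> computes \<gamma> p xs (f xs))"

section \<open>Closure under composition, recursion and minimization\<close>

lemma computable_comp:
  assumes g: "computable \<gamma> (length fs) g" and fs: "\<And>f. f \<in> set fs \<Longrightarrow> computable \<gamma> n f"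
  shows "computable \<gamma> n (\<lambda>xs. g (map (\<lambda>f. f xs) fs))"
proof -
  obtain p where p: "\<And>xs. length xs = length fs \<Longrightarrow> computes \<gamma> p xs (g xs)"
    using g unfolding computable_def by blast
  obtain q where q: "\<And>f xs. f \<in> set fs \<Longrightarrow> length xs = n \<Longrightarrow> computes \<gamma> (q f) xs (f xs)"
    using fs unfolding computable_def by metis
  have "computes \<gamma> (Comp p (map q fs)) xs (g (map (\<lambda>f. f xs) fs))" if "length xs = n" for xs
    using that by (intro computes.comp[where ys = "map (\<lambda>f. f xs) fs"]) (auto intro: p q)
  then show ?thesis unfolding computable_def by blast
qed

text \<open>These fixed-arity instances reduce a closure rule for arbitrary argument functions to
  the case where the arguments are projections; there recursion and minimization apply
  directly.\<close>

lemma computable_comp1: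
  assumes "computable \<gamma> 1 (\<lambda>xs. g (xs ! 0))" and "computable \<gamma> n f"
  shows "computable \<gamma> n (\<lambda>xs. g (f xs))"
  using computable_comp[of \<gamma> "[f]" "\<lambda>xs. g (xs ! 0)" n] assms by simp

lemma computable_comp2:
  assumes "computable \<gamma> 2 (\<lambda>xs. g (xs ! 0) (xs ! 1))"
    and "computable \<gamma> n f1" and "computable \<gamma> n f2"
  shows "computable \<gamma> n (\<lambda>xs. g (f1 xs) (f2 xs))"
  using computable_comp[of \<gamma> "[f1, f2]" "\<lambda>xs. g (xs ! 0) (xs ! 1)" n] assms
  by (auto simp: numeral_2_eq_2)

lemma computable_comp3:
  assumes "computable \<gamma> 3 (\<lambda>xs. g (xs ! 0) (xs ! 1) (xs ! 2))"
    and "computable \<gamma> n f1" and "computable \<gamma> n f2" and "computable \<gamma> n f3"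
  shows "computable \<gamma> n (\<lambda>xs. g (f1 xs) (f2 xs) (f3 xs))"
  using computable_comp[of \<gamma> "[f1, f2, f3]" "\<lambda>xs. g (xs ! 0) (xs ! 1) (xs ! 2)" n] assms
  by (auto simp: numeral_3_eq_3 numeral_2_eq_2)

lemma computable_nth: "i < n \<Longrightarrow> computable \<gamma> n (\<lambda>xs. xs ! i)"
  unfolding computable_def by (blast intro: computes.proj)

lemma computable_oracle:
  assumes "computable \<gamma> n f"
  shows "computable \<gamma> n (\<lambda>xs. \<gamma> (f xs))"
proof (rule computable_comp1[OF _ assms])
  show "computable \<gamma> 1 (\<lambda>xs. \<gamma> (xs ! 0))"
    unfolding computable_def
    by (rule exI[of _ Oracle]) (auto simp: length_Suc_conv intro: computes.oracle_call)
qed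

lemma computable_Suc:
  assumes "computable \<gamma> n f"
  shows "computable \<gamma> n (\<lambda>xs. Suc (f xs))"
proof (rule computable_comp1[OF _ assms])
  show "computable \<gamma> 1 (\<lambda>xs. Suc (xs ! 0))"
    unfolding computable_def
    by (rule exI[of _ Succ]) (auto simp: length_Suc_conv intro: computes.succ)
qed

lemma computable_const: "computable \<gamma> n (\<lambda>xs. c)"
proof (induction c)
  case 0
  show ?case unfolding computable_def by (blast intro: computes.zero)
next
  case (Suc c)
  then show ?case by (rule computable_Suc)
qed

lemma computable_primrec:
  assumes g: "computable \<gamma> n g" and h: "computable \<gamma> (Suc (Suc n)) h"
    and F0: "\<And>xs. length xs = n \<Longrightarrow> F (0 # xs) = g xs"
    and FSuc: "\<And>k xs. length xs = n \<Longrightarrow> F (Suc k # xs) = h (F (k # xs) # k # xs)"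
  shows "computable \<gamma> (Suc n) F"
proof -
  obtain p where p: "\<And>xs. length xs = n \<Longrightarrow> computes \<gamma> p xs (g xs)"
    using g unfolding computable_def by blast
  obtain q where q: "\<And>xs. length xs = Suc (Suc n) \<Longrightarrow> computes \<gamma> q xs (h xs)"
    using h unfolding computable_def by blast
  have "computes \<gamma> (PrimRec p q) (k # xs) (F (k # xs))" if xs: "length xs = n" for k xs
  proof (induction k)
    case 0
    show ?case unfolding F0[OF xs] by (rule computes.primrec_0[OF p[OF xs]])
  next
    case (Suc k)
    show ?case unfolding FSuc[OF xs]
      by (rule computes.primrec_Suc[OF Suc q]) (simp add: xs)
  qed
  then have "\<forall>ys. length ys = Suc n \<longrightarrow> computes \<gamma> (PrimRec p q) ys (F ys)"
    by (auto simp: length_Suc_conv)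
  then show ?thesis unfolding computable_def by blast
qed

text \<open>A zero exists, so the search of \<open>Mu\<close> ends; before the least zero all values
  are successors, as the rule \<open>mu\<close> demands.\<close>

lemma computable_Least:
  assumes f: "computable \<gamma> (Suc n) f" and ex: "\<And>xs. length xs = n \<Longrightarrow> \<exists>k. f (k # xs) = 0"
  shows "computable \<gamma> n (\<lambda>xs. LEAST k. f (k # xs) = 0)"
proof -
  obtain p where p: "\<And>xs. length xs = Suc n \<Longrightarrow> computes \<gamma> p xs (f xs)"
    using f unfolding computable_def by blast
  have "computes \<gamma> (Mu p) xs (LEAST k. f (k # xs) = 0)" if xs: "length xs = n" for xs
  proof (rule computes.mu)
    have "f ((LEAST k. f (k # xs) = 0) # xs) = 0" by (rule LeastI_ex[OF ex[OF xs]])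
    with p[of "(LEAST k. f (k # xs) = 0) # xs"] xs
    show "computes \<gamma> p ((LEAST k. f (k # xs) = 0) # xs) 0" by simp
    show "\<forall>m<LEAST k. f (k # xs) = 0. \<exists>y. computes \<gamma> p (m # xs) (Suc y)"
    proof (intro allI impI)
      fix m assume "m < (LEAST k. f (k # xs) = 0)"
      then have "f (m # xs) \<noteq> 0" by (rule not_less_Least)
      then obtain y where "f (m # xs) = Suc y" by (cases "f (m # xs)") auto
      with p[of "m # xs"] xs show "\<exists>y. computes \<gamma> p (m # xs) (Suc y)" by auto
    qed
  qed
  then show ?thesis unfolding computable_def by blast
qed

section \<open>Arithmetic\<close>

lemma computable_add:
  assumes "computable \<gamma> n f" and "computable \<gamma> n g"
  shows "computable \<gamma> n (\<lambda>xs. f xs + g xs)"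
proof (rule computable_comp2[OF _ assms])
  have "computable \<gamma> (Suc 1) (\<lambda>xs. xs ! 0 + xs ! 1)"
    by (rule computable_primrec[where g = "\<lambda>xs. xs ! 0" and h = "\<lambda>xs. Suc (xs ! 0)"])
      (simp_all add: computable_nth computable_Suc)
  then show "computable \<gamma> 2 (\<lambda>xs. xs ! 0 + xs ! 1)" by (simp add: numeral_2_eq_2)
qed

lemma computable_mult:
  assumes "computable \<gamma> n f" and "computable \<gamma> n g"
  shows "computable \<gamma> n (\<lambda>xs. f xs * g xs)"
proof (rule computable_comp2[OF _ assms])
  have "computable \<gamma> (Suc 1) (\<lambda>xs. xs ! 0 * xs ! 1)"
    by (rule computable_primrec[where g = "\<lambda>xs. 0" and h = "\<lambda>xs. xs ! 2 + xs ! 0"])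
      (simp_all add: computable_nth computable_add computable_const)
  then show "computable \<gamma> 2 (\<lambda>xs. xs ! 0 * xs ! 1)" by (simp add: numeral_2_eq_2)
qed

lemma computable_diff:
  assumes "computable \<gamma> n f" and "computable \<gamma> n g"
  shows "computable \<gamma> n (\<lambda>xs. f xs - g xs)"
proof -
  have pred: "computable \<gamma> (Suc 0) (\<lambda>xs. xs ! 0 - 1)"
    by (rule computable_primrec[where g = "\<lambda>xs. 0" and h = "\<lambda>xs. xs ! 1"])
      (simp_all add: computable_nth computable_const)
  \<comment> \<open>Recursion runs over the first argument, which must therefore be the subtrahend;
    the order is restored in the final composition.\<close>
  have "computable \<gamma> (Suc 1) (\<lambda>xs. xs ! 1 - xs ! 0)"
  proof (rule computable_primrec)
    show "computable \<gamma> 1 (\<lambda>xs. xs ! 0)" by (simp add: computable_nth)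
    show "computable \<gamma> (Suc (Suc 1)) (\<lambda>xs. xs ! 0 - 1)"
      by (rule computable_comp1[where g = "\<lambda>x. x - 1"]) (use pred in \<open>simp_all add: computable_nth\<close>)
  qed simp_all
  then show ?thesis
    using computable_comp2[where g = "\<lambda>x y. y - x", OF _ assms(2,1)] by (simp add: numeral_2_eq_2)
qed

lemma computable_power:
  assumes "computable \<gamma> n f"
  shows "computable \<gamma> n (\<lambda>xs. b ^ f xs)"
proof (rule computable_comp1[OF _ assms])
  have "computable \<gamma> (Suc 0) (\<lambda>xs. b ^ (xs ! 0))"
    by (rule computable_primrec[where g = "\<lambda>xs. 1" and h = "\<lambda>xs. b * xs ! 0"])
      (simp_all add: computable_nth computable_mult computable_const)
  then show "computable \<gamma> 1 (\<lambda>xs. b ^ (xs ! 0))" by simp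
qed

section \<open>Cantor pairing and its inverse\<close>

lemma computable_triangle:
  assumes "computable \<gamma> n f"
  shows "computable \<gamma> n (\<lambda>xs. triangle (f xs))"
proof (rule computable_comp1[OF _ assms])
  have "computable \<gamma> (Suc 0) (\<lambda>xs. triangle (xs ! 0))"
    by (rule computable_primrec[where g = "\<lambda>xs. 0" and h = "\<lambda>xs. xs ! 0 + Suc (xs ! 1)"])
      (simp_all add: computable_nth computable_add computable_Suc computable_const
        del: add_Suc_right)
  then show "computable \<gamma> 1 (\<lambda>xs. triangle (xs ! 0))" by simp
qed

lemma computable_prod_encode:
  assumes "computable \<gamma> n f" and "computable \<gamma> n g"
  shows "computable \<gamma> n (\<lambda>xs. prod_encode (f xs, g xs))"
  unfolding prod_encode_def using assms by (simp add: computable_add computable_triangle)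

text \<open>Since \<open>z = triangle (a + b) + a\<close> lies at or above
  \<open>triangle (a + b)\<close> and below \<open>triangle (Suc (a + b))\<close>, its diagonal
  \<open>a + b\<close> is the least \<open>s\<close> with \<open>z < triangle (Suc s)\<close>. The
  truncated difference vanishes exactly for such \<open>s\<close>, so decoding becomes a
  minimization.\<close>

lemma Least_triangle:
  "(LEAST s. Suc z - triangle (Suc s) = 0) = fst (prod_decode z) + snd (prod_decode z)"
proof -
  obtain a b where ab: "prod_decode z = (a, b)" by (cases "prod_decode z")
  then have z: "z = triangle (a + b) + a" using prod_decode_inverse[of z]
    by (simp add: prod_encode_def)
  have mono: "triangle i \<le> triangle j" if "i \<le> j" for i j :: nat
    using that by (rule lift_Suc_mono_le[rotated]) simp
  have "(LEAST s. Suc z - triangle (Suc s) = 0) = a + b"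
  proof (rule Least_equality)
    show "Suc z - triangle (Suc (a + b)) = 0" by (simp add: z)
  next
    fix s assume s: "Suc z - triangle (Suc s) = 0"
    show "a + b \<le> s"
    proof (rule ccontr)
      assume "\<not> a + b \<le> s"
      then have "triangle (Suc s) \<le> triangle (a + b)" by (intro mono) simp
      with s show False by (simp add: z)
    qed
  qed
  with ab show ?thesis by simp
qed

lemma computable_prod_decode_sum:
  assumes "computable \<gamma> n f"
  shows "computable \<gamma> n (\<lambda>xs. fst (prod_decode (f xs)) + snd (prod_decode (f xs)))"
proof (rule computable_comp1[OF _ assms])
  have "computable \<gamma> 1
      (\<lambda>xs. LEAST k. (\<lambda>ys. Suc (ys ! 1) - triangle (Suc (ys ! 0))) (k # xs) = 0)"
  proof (rule computable_Least)
    show "computable \<gamma> (Suc 1) (\<lambda>ys. Suc (ys ! 1) - triangle (Suc (ys ! 0)))"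
      by (intro computable_diff computable_Suc computable_triangle computable_nth) simp_all
    \<comment> \<open>The number \<open>z\<close> to be decoded bounds the search, as
      \<open>triangle (Suc z) = triangle z + Suc z\<close>.\<close>
    show "\<exists>k. Suc ((k # xs) ! 1) - triangle (Suc ((k # xs) ! 0)) = 0" for xs
      by (rule exI[of _ "xs ! 0"]) simp
  qed
  then show "computable \<gamma> 1
      (\<lambda>xs. fst (prod_decode (xs ! 0)) + snd (prod_decode (xs ! 0)))"
    by (simp add: Least_triangle[simplified])
qed

lemma computable_fst_prod_decode:
  assumes "computable \<gamma> n f"
  shows "computable \<gamma> n (\<lambda>xs. fst (prod_decode (f xs)))"
proof -
  have *: "z - triangle (fst (prod_decode z) + snd (prod_decode z)) = fst (prod_decode z)" for z
    using prod_decode_inverse[of z] by (cases "prod_decode z") (auto simp: prod_encode_def)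
  have "computable \<gamma> n
      (\<lambda>xs. f xs - triangle (fst (prod_decode (f xs)) + snd (prod_decode (f xs))))"
    by (intro computable_diff computable_triangle computable_prod_decode_sum assms)
  then show ?thesis by (simp only: *)
qed

lemma computable_snd_prod_decode:
  assumes "computable \<gamma> n f"
  shows "computable \<gamma> n (\<lambda>xs. snd (prod_decode (f xs)))"
proof -
  have "computable \<gamma> n (\<lambda>xs. fst (prod_decode (f xs)) + snd (prod_decode (f xs))
      - fst (prod_decode (f xs)))"
    by (intro computable_diff computable_prod_decode_sum computable_fst_prod_decode assms)
  then show ?thesis by simp
qed

section \<open>Codes of lists\<close>

text \<open>Truncated subtraction and \<open>prod_decode 0 = (0, 0)\<close> make the empty list its own tail.\<close>

primrec drop_code :: "nat \<Rightarrow> nat \<Rightarrow> nat" where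
  "drop_code 0 c = c"
| "drop_code (Suc n) c = snd (prod_decode (drop_code n c - 1))"

text \<open>On the code 0 of the empty list the value is 0, so a lookup past the end of a list still
  yields a number.\<close>

definition hd_code :: "nat \<Rightarrow> nat" where
  "hd_code c = fst (prod_decode (c - 1))"

lemma prod_decode_0: "prod_decode 0 = (0, 0)"
  by (simp add: prod_decode_def prod_decode_aux.simps)

lemma list_decode_tl: "list_decode (snd (prod_decode (c - 1))) = tl (list_decode c)"
  by (cases c) (simp_all add: prod_decode_0 split: prod.split)

lemma list_decode_drop_code: "list_decode (drop_code n c) = drop n (list_decode c)"
  by (induction n) (simp_all add: list_decode_tl[simplified] drop_Suc tl_drop)

lemma hd_code: "list_decode c \<noteq> [] \<Longrightarrow> hd_code c = hd (list_decode c)"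
  by (cases c) (simp_all add: hd_code_def split: prod.split)

lemma nth_code: "n < length (list_decode c) \<Longrightarrow> hd_code (drop_code n c) = list_decode c ! n"
  by (simp add: hd_code list_decode_drop_code hd_drop_conv_nth)

lemma list_decode_eq_Nil: "list_decode c = [] \<longleftrightarrow> c = 0"
  by (cases c) (simp_all split: prod.split)

lemma computable_drop_code:
  assumes "computable \<gamma> n f" and "computable \<gamma> n g"
  shows "computable \<gamma> n (\<lambda>xs. drop_code (f xs) (g xs))"
proof (rule computable_comp2[OF _ assms])
  have "computable \<gamma> (Suc 1) (\<lambda>xs. drop_code (xs ! 0) (xs ! 1))"
  proof (rule computable_primrec)
    show "computable \<gamma> 1 (\<lambda>xs. xs ! 0)" by (simp add: computable_nth)
    show "computable \<gamma> (Suc (Suc 1)) (\<lambda>xs. snd (prod_decode (xs ! 0 - 1)))"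
      by (intro computable_snd_prod_decode computable_diff computable_nth computable_const) simp
  qed simp_all
  then show "computable \<gamma> 2 (\<lambda>xs. drop_code (xs ! 0) (xs ! 1))" by (simp add: numeral_2_eq_2)
qed

lemma computable_hd_code:
  assumes "computable \<gamma> n f"
  shows "computable \<gamma> n (\<lambda>xs. hd_code (f xs))"
  unfolding hd_code_def
  by (intro computable_fst_prod_decode computable_diff computable_const assms)

text \<open>The length is the least number of tails that leads to 0, the only code of the empty
  list.\<close>

lemma computable_length:
  assumes "computable \<gamma> n f"
  shows "computable \<gamma> n (\<lambda>xs. length (list_decode (f xs)))"
proof (rule computable_comp1[OF _ assms])
  have zero: "drop_code k c = 0 \<longleftrightarrow> length (list_decode c) \<le> k" for k c
    unfolding list_decode_eq_Nil[symmetric] list_decode_drop_code by simp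
  have "computable \<gamma> 1 (\<lambda>xs. LEAST k. (\<lambda>ys. drop_code (ys ! 0) (ys ! 1)) (k # xs) = 0)"
    by (rule computable_Least) (auto intro: computable_drop_code computable_nth simp: zero)
  moreover have "(LEAST k. drop_code k c = 0) = length (list_decode c)" for c
    by (rule Least_equality) (simp_all add: zero)
  ultimately show "computable \<gamma> 1 (\<lambda>xs. length (list_decode (xs ! 0)))" by simp
qed

section \<open>An enumeration of the possibilistic extensions\<close>

text \<open>Turns every number into the code of a valuation, so no validity test arises:
  \<open>Suc\<close> makes the numerator positive, and the minimum keeps the fraction at most
  1.\<close>

definition clamp_code :: "nat \<Rightarrow> nat" where
  "clamp_code x = prod_encode
     (min (Suc (fst (prod_decode x))) (10 ^ snd (prod_decode x)), snd (prod_decode x))"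

text \<open>
  The valuation is looked up under the code of the formula and not under its position, so that
  repeated occurrences of a formula in a list receive the same valuation.
\<close>

definition valuation_code :: "nat \<Rightarrow> nat \<Rightarrow> nat" where
  "valuation_code w x = clamp_code (hd_code (drop_code x w))"

text \<open>Recursion over the length of a prefix is primitive recursion. It reverses the list,
  which is harmless because codes of sets ignore the order.\<close>

primrec attach :: "nat \<Rightarrow> nat \<Rightarrow> nat \<Rightarrow> nat" where
  "attach 0 c w = 0"
| "attach (Suc n) c w = Suc (prod_encode
     (prod_encode (hd_code (drop_code n c), valuation_code w (hd_code (drop_code n c))),
      attach n c w))"

text \<open>The index is a pair: the first component selects a hypothesis in
  \<open>\<gamma>\<close>, the second codes a list of raw valuations indexed by codes of
  formulas.\<close>

definition poss_hyp :: "(nat \<Rightarrow> nat) \<Rightarrow> nat \<Rightarrow> nat" where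
  "poss_hyp \<gamma> n = attach (length (list_decode (\<gamma> (fst (prod_decode n)))))
     (\<gamma> (fst (prod_decode n))) (snd (prod_decode n))"

lemma list_decode_attach:
  "n \<le> length (list_decode c) \<Longrightarrow> list_decode (attach n c w) =
     rev (map (\<lambda>x. prod_encode (x, valuation_code w x)) (take n (list_decode c)))"
  by (induction n) (simp_all add: nth_code take_Suc_conv_app_nth)

lemma computable_valuation_code:
  assumes "computable \<gamma> n f" and "computable \<gamma> n g"
  shows "computable \<gamma> n (\<lambda>xs. valuation_code (f xs) (g xs))"
proof -
  \<comment> \<open>Reduces the minimum to truncated subtraction, whose computability is at
    hand.\<close>
  have min_diff: "min a b = a - (a - b)" for a b :: nat by simp
  show ?thesis
    unfolding valuation_code_def clamp_code_def min_diff
    by (intro computable_prod_encode computable_diff computable_Suc computable_fst_prod_decode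
        computable_snd_prod_decode computable_power computable_hd_code computable_drop_code assms)
qed

lemma computable_attach:
  assumes "computable \<gamma> n f" and "computable \<gamma> n g" and "computable \<gamma> n h"
  shows "computable \<gamma> n (\<lambda>xs. attach (f xs) (g xs) (h xs))"
proof (rule computable_comp3[OF _ assms])
  have "computable \<gamma> (Suc 2) (\<lambda>xs. attach (xs ! 0) (xs ! 1) (xs ! 2))"
  proof (rule computable_primrec)
    \<comment> \<open>Here \<open>xs\<close> consists of the recursive value, the counter, the code
      of the list and the code of the valuations.\<close>
    show "computable \<gamma> (Suc (Suc 2)) (\<lambda>xs. Suc (prod_encode
       (prod_encode (hd_code (drop_code (xs ! 1) (xs ! 2)),
          valuation_code (xs ! 3) (hd_code (drop_code (xs ! 1) (xs ! 2)))), xs ! 0)))"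
      by (intro computable_Suc computable_prod_encode computable_hd_code computable_drop_code
          computable_valuation_code computable_nth) simp_all
  qed (simp_all add: computable_const numeral_3_eq_3 numeral_2_eq_2)
  then show "computable \<gamma> 3 (\<lambda>xs. attach (xs ! 0) (xs ! 1) (xs ! 2))"
    by (simp add: numeral_3_eq_3 numeral_2_eq_2)
qed

text \<open>This is where the oracle enters: it supplies the codes of the hypotheses, and all that
  is done with them is recursive.\<close>

lemma computable_poss_hyp:
  assumes "computable \<gamma> n f"
  shows "computable \<gamma> n (\<lambda>xs. poss_hyp \<gamma> (f xs))"
  unfolding poss_hyp_def
  by (intro computable_attach computable_length computable_oracle computable_fst_prod_decode
      computable_snd_prod_decode assms)

section \<open>Valuations as decimals\<close>

definition decimal :: "nat \<Rightarrow> real" where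
  "decimal c = real (fst (prod_decode c)) / 10 ^ snd (prod_decode c)"

lemma decimal_code_iff: "decimal_code c \<alpha> \<longleftrightarrow> \<alpha> = decimal c"
  by (simp add: decimal_code_def decimal_def split: prod.split)

lemma decimal_clamp_code: "decimal (clamp_code x) \<in> valuations"
proof -
  define m k where "m = min (Suc (fst (prod_decode x))) (10 ^ snd (prod_decode x))"
    and "k = snd (prod_decode x)"
  have "0 < m" "m \<le> 10 ^ k" by (simp_all add: m_def k_def)
  then have "0 < real m" "real m \<le> real (10 ^ k)"
    by (simp_all only: of_nat_le_iff of_nat_0_less_iff)
  then have "0 < real m / 10 ^ k" "real m / 10 ^ k \<le> 1" by simp_all
  moreover have "decimal (clamp_code x) = real m / 10 ^ k"
    by (simp add: decimal_def clamp_code_def m_def k_def)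
  ultimately show ?thesis unfolding valuations_def by auto
qed

lemma decimal_clamp_code_surj:
  assumes "\<alpha> \<in> valuations"
  shows "\<exists>x. decimal (clamp_code x) = \<alpha>"
proof -
  obtain m k where mk: "\<alpha> = real m / 10 ^ k" "0 < \<alpha>" "\<alpha> \<le> 1"
    using assms unfolding valuations_def by blast
  then have "real m \<le> real (10 ^ k)" by (simp add: divide_le_eq)
  then have "m \<le> 10 ^ k" by (simp only: of_nat_le_iff)
  moreover have "0 < m" using mk by (cases m) auto
  \<comment> \<open>The witness \<open>m - 1\<close> compensates for the \<open>Suc\<close> in
    \<open>clamp_code\<close>; the cap leaves \<open>m\<close> unchanged.\<close>
  ultimately have "decimal (clamp_code (prod_encode (m - 1, k))) = \<alpha>"
    by (simp add: decimal_def clamp_code_def mk)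
  then show ?thesis by blast
qed

text \<open>A finite set of numbers is bounded by some \<open>n\<close>, so one list of length
  \<open>n\<close> can store the prescribed value at every position in the set.\<close>

lemma valuation_code_surj:
  assumes "finite S"
  shows "\<exists>w. \<forall>x \<in> S. valuation_code w x = clamp_code (f x)"
proof -
  obtain n where n: "\<forall>x \<in> S. x < n"
    using assms finite_nat_set_iff_bounded by blast
  define w where "w = list_encode (map f [0..<n])"
  have "valuation_code w x = clamp_code (f x)" if "x \<in> S" for x
    using that n by (simp add: valuation_code_def nth_code w_def)
  then show ?thesis by blast
qed

section \<open>Soundness and completeness of the enumeration\<close>

lemma set_code_fm_code_iff: "set_code fm_code c l \<longleftrightarrow> set (list_decode c) = fm_encode ` l"
  by (auto simp: set_code_def fm_code_def rel_set_def)

text \<open>Passing to \<open>set\<close> removes the reversal made by \<open>attach\<close>. As the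
  valuation depends only on the code of the formula, the result is the image of \<open>l\<close>
  under a single map.\<close>

lemma set_code_poss_hyp:
  assumes "set_code fm_code (\<gamma> i) l"
  shows "set_code pfm_code (poss_hyp \<gamma> (prod_encode (i, w)))
           ((\<lambda>\<phi>. (\<phi>, decimal (valuation_code w (fm_encode \<phi>)))) ` l)"
proof -
  have "set (list_decode (poss_hyp \<gamma> (prod_encode (i, w)))) =
      (\<lambda>x. prod_encode (x, valuation_code w x)) ` fm_encode ` l"
    using assms by (simp add: poss_hyp_def list_decode_attach set_code_fm_code_iff)
  then show ?thesis
    by (auto simp: set_code_def rel_set_def pfm_code_def fm_code_def decimal_code_iff)
qed

text \<open>Every index gives a legal query: \<open>w\<close> may be arbitrary since
  \<open>clamp_code\<close> turns whatever is looked up into a valuation.\<close>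

lemma poss_hyp_sound:
  assumes "enumerates_hyps \<gamma> F"
  shows "\<exists>h \<in> snd (poss_framework U F). set_code pfm_code (poss_hyp \<gamma> n) h"
proof -
  obtain i w where n: "n = prod_encode (i, w)" by (metis prod_decode_inverse surj_pair)
  obtain l where l: "l \<in> snd F" "set_code fm_code (\<gamma> i) l"
    using assms unfolding enumerates_hyps_def by blast
  have "(\<lambda>\<phi>. (\<phi>, decimal (valuation_code w (fm_encode \<phi>)))) ` l \<in> pextensions l"
    unfolding pextensions_def
    by (rule CollectI, rule exI[of _ "\<lambda>\<phi>. decimal (valuation_code w (fm_encode \<phi>))"])
      (simp add: valuation_code_def decimal_clamp_code)
  then show ?thesis
    using l set_code_poss_hyp[of \<gamma> i l w, OF l(2)] unfolding n poss_framework_def Let_def by auto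
qed

lemma poss_hyp_complete:
  assumes "enumerates_hyps \<gamma> F" and "h \<in> snd (poss_framework U F)"
  shows "\<exists>n. set_code pfm_code (poss_hyp \<gamma> n) h"
proof -
  obtain l v where l: "l \<in> snd F" and h: "h = (\<lambda>\<phi>. (\<phi>, v \<phi>)) ` l"
    and v: "\<forall>\<phi> \<in> l. v \<phi> \<in> valuations"
    using assms(2) unfolding poss_framework_def Let_def pextensions_def by auto
  obtain i where i: "set_code fm_code (\<gamma> i) l"
    using assms(1) l unfolding enumerates_hyps_def by blast
  have "\<forall>\<phi> \<in> l. \<exists>x. decimal (clamp_code x) = v \<phi>"
    using v decimal_clamp_code_surj by blast
  from bchoice[OF this] obtain g where g: "\<forall>\<phi> \<in> l. decimal (clamp_code (g \<phi>)) = v \<phi>"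
    by blast
  \<comment> \<open>Finiteness is read off the code \<open>\<gamma> i\<close>, which lists the
    encoded formulas.\<close>
  have "finite (fm_encode ` l)"
    using finite_set[of "list_decode (\<gamma> i)"] i by (simp only: set_code_fm_code_iff)
  \<comment> \<open>The list \<open>w\<close> is indexed by codes, so \<open>g\<close> is
    transported along the inverse of the injective \<open>fm_encode\<close>.\<close>
  then obtain w where
    w: "\<forall>x \<in> fm_encode ` l. valuation_code w x = clamp_code (g (inv fm_encode x))"
    using valuation_code_surj[where f = "\<lambda>x. g (inv fm_encode x)"] by blast
  have "inj fm_encode" by (rule injI) (rule fm_encode_inject)
  then have "(\<lambda>\<phi>. (\<phi>, decimal (valuation_code w (fm_encode \<phi>)))) ` l = h"
    unfolding h using w g by (intro image_cong) simp_all
  with set_code_poss_hyp[of \<gamma> i l w, OF i] show ?thesis by auto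
qed

text \<open>Each element of \<open>A\<close> shares a code in the list with an element of
  \<open>B\<close>, and conversely. This will identify the target with a member of the
  enumeration.\<close>

lemma set_code_unique:
  assumes "\<And>c x y. C c x \<Longrightarrow> C c y \<Longrightarrow> x = y" and "set_code C c A" and "set_code C c B"
  shows "A = B"
  using assms unfolding set_code_def rel_set_def by (metis subsetI subset_antisym)

lemma pfm_code_unique: "pfm_code c e \<Longrightarrow> pfm_code c e' \<Longrightarrow> e = e'"
  by (cases e; cases e')
    (auto simp: pfm_code_def fm_code_def decimal_code_iff split: prod.splits
      dest: fm_encode_inject)

section \<open>The learner\<close>

text \<open>An arithmetical test for a history whose latest answer is 0. The first factor excludes
  the empty history, whose \<open>hd_code\<close> is 0 too.\<close>

definition yes_flag :: "nat \<Rightarrow> nat" where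
  "yes_flag c = (1 - (1 - c)) * (1 - hd_code c)"

text \<open>
  The flag turns the code of \<open>Inl\<close> into that of \<open>Inr\<close>, and it lowers the index, which is the number
  of answers, to that of the hypothesis that has been confirmed.
\<close>

definition next_action :: "(nat \<Rightarrow> nat) \<Rightarrow> nat \<Rightarrow> nat" where
  "next_action \<gamma> c =
     2 * poss_hyp \<gamma> (length (list_decode c) - yes_flag c) + yes_flag c"

lemma computable_next_action:
  assumes "computable \<gamma> n f"
  shows "computable \<gamma> n (\<lambda>xs. next_action \<gamma> (f xs))"
  unfolding next_action_def yes_flag_def
  by (intro computable_add computable_mult computable_diff computable_const computable_poss_hyp
      computable_length computable_hd_code assms)

lemma next_action_query:
  assumes "as = [] \<or> hd as \<noteq> 0"
  shows "next_action \<gamma> (list_encode as) = sum_encode (Inl (poss_hyp \<gamma> (length as)))"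
proof -
  have "yes_flag (list_encode as) = 0"
    using assms by (cases as) (simp_all add: yes_flag_def hd_code_def)
  then show ?thesis by (simp add: next_action_def sum_encode_def)
qed

lemma next_action_halt:
  "next_action \<gamma> (list_encode (0 # as)) = sum_encode (Inr (poss_hyp \<gamma> (length as)))"
proof -
  have "yes_flag (list_encode (0 # as)) = 1"
    by (simp add: yes_flag_def hd_code_def)
  then show ?thesis
    unfolding next_action_def by (simp add: sum_encode_def del: list_encode.simps)
qed

lemma succeeds_enumeration:
  assumes p: "\<And>as. computes \<gamma> p [\<sigma>, list_encode as] (next_action \<gamma> (list_encode as))"
    and code: "\<And>n. set_code pfm_code (poss_hyp \<gamma> n) (H n)" and H: "\<And>n. H n \<in> snd F"
    and "t = H N" and "length as \<le> N" and "as = [] \<or> hd as \<noteq> 0"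
  shows "succeeds \<gamma> (poss_logic U) F p t \<sigma> as"
  using assms(5,6)
proof (induction "N - length as" arbitrary: as rule: less_induct)
  case less
  show ?case
  proof (rule succeeds.query)
    show "computes \<gamma> p [\<sigma>, list_encode as] (sum_encode (Inl (poss_hyp \<gamma> (length as))))"
      using p[of as] next_action_query[OF less.prems(2)] by metis
    show "hyp_code (poss_logic U) (poss_hyp \<gamma> (length as)) (H (length as))"
      by (simp add: poss_logic_def code)
    show "\<forall>a. eq_answer (poss_logic U) F t (H (length as)) a \<longrightarrow>
        succeeds \<gamma> (poss_logic U) F p t \<sigma> (a # as)"
    proof (intro allI impI)
      fix a assume a: "eq_answer (poss_logic U) F t (H (length as)) a"
      show "succeeds \<gamma> (poss_logic U) F p t \<sigma> (a # as)"
      proof (cases "equivalent (poss_logic U) (H (length as)) t")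
        case True
        with a have "a = 0" by (simp add: eq_answer_def)
        \<comment> \<open>The next action halts with the hypothesis just confirmed, whose index is
          again \<open>length as\<close>.\<close>
        with p[of "0 # as"] True show ?thesis
          unfolding next_action_halt
          by (intro succeeds.halt) (auto simp: poss_logic_def intro: code H)
      next
        case False
        \<comment> \<open>A query of \<open>H N\<close> is a query of the target, which is
          equivalent to itself; hence the index is still below \<open>N\<close> and the distance
          decreases.\<close>
        then have "length as \<noteq> N"
          using \<open>t = H N\<close> by (auto simp: poss_logic_def pequiv_def)
        moreover have "a \<noteq> 0" using a False by (auto simp: eq_answer_def)
        ultimately show ?thesis using less.prems by (intro less.hyps) auto
      qed
    qed
  qed (rule H)
qed

theorem theorem3:
  fixes F :: "(fm, fm set) framework" and \<gamma> :: "nat \<Rightarrow> nat"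
  assumes "FO_framework F" and "enumerates_hyps \<gamma> F"
  shows "learnable_eq \<gamma> (poss_logic TYPE('u)) (poss_framework TYPE('u) F)"
proof -
  let ?F = "poss_framework TYPE('u) F"
  have "computable \<gamma> 2 (\<lambda>xs. next_action \<gamma> (xs ! 1))"
    by (intro computable_next_action computable_nth) simp
  then obtain p where "\<And>xs. length xs = 2 \<Longrightarrow> computes \<gamma> p xs (next_action \<gamma> (xs ! 1))"
    unfolding computable_def by blast
  from this[of "[_, _]"]
  have p: "computes \<gamma> p [\<sigma>, c] (next_action \<gamma> c)" for \<sigma> c by simp
  obtain H where H: "\<And>n. H n \<in> snd ?F" "\<And>n. set_code pfm_code (poss_hyp \<gamma> n) (H n)"
    using poss_hyp_sound[OF assms(2), of "TYPE('u)"] by metis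
  have "succeeds \<gamma> (poss_logic TYPE('u)) ?F p t \<sigma> []" if t: "t \<in> snd ?F" for t \<sigma>
  proof -
    obtain N where "set_code pfm_code (poss_hyp \<gamma> N) t"
      using poss_hyp_complete[OF assms(2) t] by blast
    \<comment> \<open>The code at index \<open>N\<close> denotes both \<open>t\<close> and the
      hypothesis chosen as \<open>H N\<close>, and a code denotes at most one set.\<close>
    then have "t = H N"
      by (intro set_code_unique[of pfm_code _ t "H N", OF _ _ H(2)] pfm_code_unique)
    then show ?thesis by (intro succeeds_enumeration[OF p H(2,1)]) auto
  qed
  then show ?thesis unfolding learnable_eq_def by blast
qed

end
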